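(* Consider the problem of estimating $\mathrm{Avg}(f)=\int_0^1f(x)\,dx$ for $1$-Lipschitz $f:[0,1]\to\mathbb{R}$ from one sample. The uniform distribution on $[2-\sqrt3,\sqrt3-1]$, combined with outputting the observed value $f(x)$, minimizes the worst-case expected estimation error among all randomized sampling algorithms, and its worst-case expected error is $1-\frac{\sqrt3}{2}$.
   Context: A randomized sampling algorithm is a pair $(p,g)$ of a probability density $p$ on $[0,1]$ and a prediction function $g:[0,1]\times\mathbb{R}\to\mathbb{R}$; it samples $x\sim p$ and outputs $g(x,f(x))$. Its worst-case expected error is $\sup_f\int_0^1p(x)|\mathrm{Avg}(f)-g(x,f(x))|\,dx$, the supremum over all $1$-Lipschitz $f:[0,1]\to\mathbb{R}$. *)

theory Defs
  imports "HOL-Analysis.Analysis"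
begin

text \<open>
  Functions on $[0,1]$ are total functions on \<^typ>\<open>real\<close> of which only the values on
  \<^term>\<open>{0..1::real}\<close> matter; \<^term>\<open>lebesgue_on {0..1::real}\<close> is Lebesgue measure on $[0,1]$.
\<close>

definition Avg :: "(real \<Rightarrow> real) \<Rightarrow> real" where
  "Avg f = integral {0..1} f"

definition prob_density :: "(real \<Rightarrow> real) \<Rightarrow> bool" where
  "prob_density p \<longleftrightarrow>
     p \<in> borel_measurable (lebesgue_on {0..1}) \<and>
     (\<forall>x\<in>{0..1}. 0 \<le> p x) \<and>
     (\<integral>\<^sup>+x. ennreal (p x) \<partial>lebesgue_on {0..1}) = 1"

type_synonym sampling_alg = "(real \<Rightarrow> real) \<times> (real \<times> real \<Rightarrow> real)"

text \<open>
  Joint measurability of the prediction function $g$ is the usual tacit assumption; it makes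
  $x \mapsto g(x, f(x))$ Lebesgue measurable on $[0,1]$ for every continuous $f$, so that
  the expected error below is a genuine integral.
\<close>

definition randomized_sampling_alg :: "sampling_alg \<Rightarrow> bool" where
  "randomized_sampling_alg = (\<lambda>(p, g).
     prob_density p \<and>
     g \<in> borel_measurable (lebesgue_on {0..1} \<Otimes>\<^sub>M (borel :: real measure)))"

definition expected_error :: "sampling_alg \<Rightarrow> (real \<Rightarrow> real) \<Rightarrow> ennreal" where
  "expected_error = (\<lambda>(p, g) f.
     \<integral>\<^sup>+x. ennreal (p x * \<bar>Avg f - g (x, f x)\<bar>) \<partial>lebesgue_on {0..1})"

text \<open>
  The error is valued in the extended nonnegative reals, since the supremum (and even a single
  expected error) may be infinite for a poor algorithm.
\<close>

definition worst_case_error :: "sampling_alg \<Rightarrow> ennreal" where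
  "worst_case_error A = (SUP f \<in> {f. 1-lipschitz_on {0..1} f}. expected_error A f)"

definition uniform_density :: "real \<Rightarrow> real \<Rightarrow> real \<Rightarrow> real" where
  "uniform_density a b x = indicator {a..b} x / (b - a)"

end

theory Submission imports Defs begin

text \<open>
  Write $a = 2 - \sqrt 3$, so that the sampling interval is $[a, 1-a]$, $a^2 = 4a - 1$, and the
  claimed error is $a/2$.

  Lower bound (Yao's principle): let $t = (1+a)/2$ and consider the two shapes $|x-t| - a$ and
  $|x-(1-t)| - a$. Both have average $0$, and their absolute values add up to at least $a$ at every
  point of $[0,1]$. Giving a shape a random sign and adding a constant $c$ uniform on a long
  interval $[-K,K]$ makes the sample value uninformative, so every algorithm errs by at least
  $(1 - 1/K)\,a/2$.

  Upper bound: with $f_0 = f - \mathrm{Avg}(f)$, $\sigma = \mathrm{sgn} \circ f_0$ and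
  $\lambda = \int_a^{1-a} \sigma$, we have $\int_a^{1-a} |f_0| = \int_0^1 \varphi f_0$ for
  $\varphi = \sigma 1_{[a,1-a]} - \lambda$. Integration by parts bounds this by
  $\int_0^1 |\Phi|$, where $\Phi$ is the antiderivative of $\varphi$; it vanishes at $0$ and $1$.
  Since $\Phi$ has slopes in $[-1-\lambda, 1-\lambda]$ on $[a,1-a]$ and runs there from $-\lambda a$
  to $\lambda a$, its first and last zeros give piecewise linear bounds whose areas add up to at most
  $(1/2 - a)\,a$.
\<close>

section \<open>Upper bound: elementary estimates\<close>

text \<open>Over \<open>n\<close> equal steps the defects add up to
  \<open>C * (b - a)\<^sup>2 / n\<close>, which tends to 0. This replaces a derivative test for
  functions built from a merely Lipschitz \<open>f\<close>.\<close>

lemma mono_of_quadratic_defect: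
  fixes K :: "real \<Rightarrow> real"
  assumes "a \<le> b" and K: "\<And>x y. a \<le> x \<Longrightarrow> x \<le> y \<Longrightarrow> y \<le> b \<Longrightarrow> K x - C * (y - x)\<^sup>2 \<le> K y"
  shows "K a \<le> K b"
proof (rule field_le_epsilon)
  fix e :: real assume "e > 0"
  obtain n :: nat where n: "\<bar>C\<bar> * (b - a)\<^sup>2 / e < real n"
    using reals_Archimedean2 by blast
  moreover have "0 \<le> \<bar>C\<bar> * (b - a)\<^sup>2 / e" using \<open>e > 0\<close> by simp
  ultimately have "real n > 0" by linarith
  with n have n: "n > 0" "\<bar>C\<bar> * (b - a)\<^sup>2 / e < real n" by auto
  define x where "x i = a + (b - a) * real i / real n" for i
  have x_bounds: "a \<le> x i" "x i \<le> b" if "i \<le> n" for i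
  proof -
    show "a \<le> x i" using assms(1) by (simp add: x_def)
    have "(b - a) * (real i / real n) \<le> (b - a) * 1"
      using assms(1) that n(1) by (intro mult_left_mono) auto
    then show "x i \<le> b" by (simp add: x_def)
  qed
  have step: "x (Suc i) - x i = (b - a) / n" for i
    using n(1) by (simp add: x_def field_simps)
  have "K a - C * ((b - a) / n)\<^sup>2 * real i \<le> K (x i)" if "i \<le> n" for i
    using that
  proof (induction i)
    case 0
    then show ?case by (simp add: x_def)
  next
    case (Suc i)
    have "x i \<le> x (Suc i)"
      using step[of i] assms(1) by (metis diff_ge_0_iff_ge divide_nonneg_nonneg of_nat_0_le_iff)
    from K[OF x_bounds(1)[of i] this x_bounds(2)[of "Suc i"]] Suc
    show ?case by (simp add: step algebra_simps)
  qed
  from this[of n] have "K a - C * ((b - a) / n)\<^sup>2 * real n \<le> K b"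
    using n(1) by (simp add: x_def)
  moreover have "C * ((b - a) / n)\<^sup>2 * real n = C * (b - a)\<^sup>2 / n"
    using n(1) by (simp add: power2_eq_square)
  moreover have "C * (b - a)\<^sup>2 / n \<le> \<bar>C\<bar> * (b - a)\<^sup>2 / n"
    by (intro divide_right_mono mult_right_mono) auto
  moreover have "\<bar>C\<bar> * (b - a)\<^sup>2 / n \<le> e"
    using n \<open>e > 0\<close> by (simp add: field_simps)
  ultimately show "K a \<le> K b + e" by linarith
qed

text \<open>
  The variables \<open>d\<close>, \<open>w\<close>, \<open>d'\<close> are the distances from the left endpoint to the first zero of the
  bridge, between its outer zeros, and from the last zero to the right endpoint. Equality holds, up to
  exchanging \<open>d\<close> and \<open>d'\<close>, for $w = 0$, $d = \lambda a/(1-\lambda)$ and $\lambda \in \{a, 2h\}$, which is visible in the factorization below.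
\<close>

lemma bridge_area_le:
  fixes a h l d d' w :: real
  assumes a: "a * a = 4 * a - 1" "0 < a" and h: "h = 1/2 - a" "0 < h" "h \<le> a"
    and l: "0 \<le> l" "l \<le> 2 * h" and sum: "d + w + d' = 2 * h" and w: "0 \<le> w"
    and d: "l * a \<le> (1 - l) * d" "l * a \<le> (1 - l) * d'" "0 \<le> d" "0 \<le> d'"
  shows "l * a\<^sup>2 + (1 - l\<^sup>2) * (d\<^sup>2 + d'\<^sup>2) / 4 + (1 - l) * (l * a) * (d + d') / 2 - (l * a)\<^sup>2 / 2
     + (1 + l) * w\<^sup>2 / 4 \<le> h * a" (is "?P \<le> _")
proof -
  \<comment> \<open>\<open>X\<close> and \<open>Y\<close> are the slacks in the lower bounds on
    \<open>d\<close> and \<open>d'\<close>. Multiplying the claim by \<open>1 - l\<close> makes it a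
    polynomial in them, which turns into a sum of products once \<open>a * a = 4 * a - 1\<close> is
    used.\<close>
  define X where "X = (1 - l) * d - l * a"
  define Y where "Y = (1 - l) * d' - l * a"
  define Z where "Z = (1 - l) * w"
  have "l < 1" using l h a by linarith
  have d': "d' = 2 * h - d - w" using sum by simp
  have "16 * (1 - l) * (h * a - ?P) = 4 * ((2 * h - l) * (l - a)\<^sup>2
      + 2 * (1 + l) * (X * Y + (X + Y) * Z) + Z * l * (4 * a - (1 + l) * w))"
    using a(1) unfolding d' X_def Y_def Z_def h(1) power2_eq_square
    by (simp add: field_simps, algebra)
  moreover have "0 \<le> X" "0 \<le> Y" "0 \<le> Z"
    using d w \<open>l < 1\<close> by (auto simp: X_def Y_def Z_def)
  \<comment> \<open>The sign of the last factor, \<open>4 * a - (1 + l) * w\<close>, is the only one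
    that is not immediate; it follows from this bound and \<open>h \<le> a\<close>.\<close>
  moreover have "(1 + l) * w \<le> 2 * (2 * h)"
    using l w \<open>l < 1\<close> sum d by (intro mult_mono) auto
  ultimately have "0 \<le> 16 * (1 - l) * (h * a - ?P)"
    using l h by (simp)
  then show ?thesis using \<open>l < 1\<close> by (simp add: zero_le_mult_iff)
qed

text \<open>Integrates one affine majorant on each side of \<open>m\<close>. Nonzero end values
  \<open>A\<close>, \<open>B\<close> occur where the bridge starts or ends away from 0, and
  \<open>m = p\<close> or \<open>m = q\<close> leaves a single affine piece.\<close>

lemma integral_abs_le_tent:
  fixes v :: "real \<Rightarrow> real"
  assumes v: "continuous_on {p..q} v" and m: "p \<le> m" "m \<le> q"
    and left: "\<And>x. p \<le> x \<Longrightarrow> x \<le> m \<Longrightarrow> \<bar>v x\<bar> \<le> A + r * (x - p)"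
    and right: "\<And>x. m \<le> x \<Longrightarrow> x \<le> q \<Longrightarrow> \<bar>v x\<bar> \<le> B + s * (q - x)"
  shows "integral {p..q} (\<lambda>x. \<bar>v x\<bar>)
     \<le> A * (m - p) + r * (m - p)\<^sup>2 / 2 + (B * (q - m) + s * (q - m)\<^sup>2 / 2)"
proof -
  have int: "(\<lambda>x. \<bar>v x\<bar>) integrable_on {p..q}"
    using v by (intro integrable_continuous_real continuous_intros)
  have 1: "((\<lambda>x. A + r * (x - p)) has_integral A * (m - p) + r * (m - p)\<^sup>2 / 2) {p..m}"
    by (rule has_integral_eq_rhs[OF fundamental_theorem_of_calculus[OF m(1),
          where f = "\<lambda>x. A * (x - p) + r * (x - p)\<^sup>2 / 2"]])
      (auto intro!: derivative_eq_intros simp flip: has_real_derivative_iff_has_vector_derivative)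
  have 2: "((\<lambda>x. B + s * (q - x)) has_integral B * (q - m) + s * (q - m)\<^sup>2 / 2) {m..q}"
    by (rule has_integral_eq_rhs[OF fundamental_theorem_of_calculus[OF m(2),
          where f = "\<lambda>x. - B * (q - x) - s * (q - x)\<^sup>2 / 2"]])
      (auto intro!: derivative_eq_intros simp: field_simps simp flip: has_real_derivative_iff_has_vector_derivative)
  have "integral {p..q} (\<lambda>x. \<bar>v x\<bar>) = integral {p..m} (\<lambda>x. \<bar>v x\<bar>) + integral {m..q} (\<lambda>x. \<bar>v x\<bar>)"
    using Henstock_Kurzweil_Integration.integral_combine[OF m int] by simp
  moreover have "integral {p..m} (\<lambda>x. \<bar>v x\<bar>) \<le> A * (m - p) + r * (m - p)\<^sup>2 / 2"
    using left by (intro has_integral_le[OF integrable_integral 1] integrable_subinterval_real[OF int])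
      (use m in auto)
  moreover have "integral {m..q} (\<lambda>x. \<bar>v x\<bar>) \<le> B * (q - m) + s * (q - m)\<^sup>2 / 2"
    using right by (intro has_integral_le[OF integrable_integral 2] integrable_subinterval_real[OF int])
      (use m in auto)
  ultimately show ?thesis by linarith
qed

section \<open>Upper bound: integration by parts against a Lipschitz function\<close>

text \<open>For smooth \<open>f\<close> the left side is minus the integral of \<open>\<Phi>\<close>
  times the derivative of \<open>f\<close>, where \<open>\<Phi>\<close> is the antiderivative of
  \<open>\<phi>\<close>: the boundary terms vanish because \<open>\<phi>\<close> has integral 0, and
  the derivative of \<open>f\<close> is at most 1 in absolute value.\<close>

lemma integral_mult_lipschitz_le:
  fixes f \<phi> :: "real \<Rightarrow> real"
  assumes f: "1-lipschitz_on {0..1} f"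
    and \<phi>: "\<phi> integrable_on {0..1}" "(\<lambda>x. \<phi> x * f x) integrable_on {0..1}"
    and C: "\<And>x. x \<in> {0..1} \<Longrightarrow> \<bar>\<phi> x\<bar> \<le> C"
    and 0: "integral {0..1} \<phi> = 0"
  shows "integral {0..1} (\<lambda>x. \<phi> x * f x) \<le> integral {0..1} (\<lambda>y. \<bar>integral {0..y} \<phi>\<bar>)"
proof -
  define \<Phi> where "\<Phi> y = integral {0..y} \<phi>" for y
  have "continuous_on {0..1} \<Phi>"
    unfolding \<Phi>_def using \<phi>(1) by (rule indefinite_integral_continuous_1)
  then have abs_int: "(\<lambda>y. \<bar>\<Phi> y\<bar>) integrable_on {0..1}"
    by (intro integrable_continuous_real continuous_intros)
  \<comment> \<open>\<open>J\<close> is 0 at 0, and since \<open>\<Phi> 1 = 0\<close> its value at 1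
    is the right side of the claim minus the left side.\<close>
  define J where "J y = integral {0..y} (\<lambda>y. \<bar>\<Phi> y\<bar>) - (integral {0..y} (\<lambda>x. \<phi> x * f x) - \<Phi> y * f y)" for y
  (* Integration by parts without differentiating f: J is monotone up to an error quadratic
     in the length of the interval, hence monotone. *)
  have "J 0 \<le> J 1"
  proof (rule mono_of_quadratic_defect[where K = J and a = 0 and b = 1 and C = "2 * C"])
    fix x y :: real assume xy: "0 \<le> x" "x \<le> y" "y \<le> 1"
    have sub: "g integrable_on {x..y}" if "g integrable_on {0..1}" for g :: "real \<Rightarrow> real"
      using that by (rule integrable_subinterval_real) (use xy in auto)
    have comb: "integral {0..y} g = integral {0..x} g + integral {x..y} g"
      if "g integrable_on {0..1}" for g :: "real \<Rightarrow> real"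
      using Henstock_Kurzweil_Integration.integral_combine[OF xy(1,2), of g]
        integrable_subinterval_real[OF that, of 0 y] xy by auto
    have lip: "\<bar>f s - f x\<bar> \<le> s - x" if "x \<le> s" "s \<le> y" for s
      using lipschitz_onD[OF f, of s x] that xy by (auto simp: dist_real_def)
    have "0 \<le> C" using C[of 0] by auto
    have \<Phi>diff: "\<bar>\<Phi> y - \<Phi> s\<bar> \<le> C * (y - x)" if "x \<le> s" "s \<le> y" for s
    proof -
      have "\<Phi> y - \<Phi> s = integral {s..y} \<phi>"
        using Henstock_Kurzweil_Integration.integral_combine[of 0 s y \<phi>]
          integrable_subinterval_real[OF \<phi>(1), of 0 y] xy that by (auto simp: \<Phi>_def)
      moreover have "norm (integral {s..y} \<phi>) \<le> C * (y - s)"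
        using that xy C \<open>0 \<le> C\<close> integrable_subinterval_real[OF \<phi>(1), of s y]
          has_integral_bound_real[of C "{}" \<phi> "integral {s..y} \<phi>" s y]
        by (auto simp: integrable_integral)
      moreover have "C * (y - s) \<le> C * (y - x)"
        using that \<open>0 \<le> C\<close> by (intro mult_left_mono) auto
      ultimately show ?thesis by simp
    qed
    have prod_int: "(\<lambda>s. \<phi> s * f s - f x * \<phi> s) integrable_on {x..y}"
      using \<phi> by (intro integrable_diff integrable_on_mult_right sub)
    \<comment> \<open>First quadratic error: freezing \<open>f\<close> at its value at
      \<open>x\<close>.\<close>
    have "integral {x..y} (\<lambda>s. \<phi> s * f s) - f x * integral {x..y} \<phi>
        = integral {x..y} (\<lambda>s. \<phi> s * f s - f x * \<phi> s)"
      using \<phi> by (subst Henstock_Kurzweil_Integration.integral_diff) (auto intro: sub integrable_on_mult_right)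
    also have "\<dots> \<le> integral {x..y} (\<lambda>s. C * (y - x))"
    proof (intro integral_le prod_int)
      fix s assume s: "s \<in> {x..y}"
      have "\<phi> s * f s - f x * \<phi> s \<le> \<bar>\<phi> s\<bar> * \<bar>f s - f x\<bar>"
        by (metis abs_mult abs_ge_self mult.commute right_diff_distrib')
      also have "\<dots> \<le> C * (y - x)"
        using s xy C[of s] lip[of s] \<open>0 \<le> C\<close> by (intro mult_mono) auto
      finally show "\<phi> s * f s - f x * \<phi> s \<le> C * (y - x)" .
    qed auto
    finally have 1: "integral {x..y} (\<lambda>s. \<phi> s * f s) - f x * integral {x..y} \<phi> \<le> C * (y - x)\<^sup>2"
      using xy by (simp add: power2_eq_square mult_ac)
    \<comment> \<open>Second quadratic error: replacing \<open>\<Phi> y\<close> by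
      \<open>\<Phi> s\<close> under the integral. The two errors account for the constant
      \<open>2 * C\<close>.\<close>
    have "- (\<Phi> y * (f y - f x)) \<le> \<bar>\<Phi> y\<bar> * \<bar>f y - f x\<bar>"
      by (metis abs_ge_minus_self abs_mult)
    also have "\<dots> \<le> \<bar>\<Phi> y\<bar> * (y - x)"
      using lip[of y] xy by (intro mult_left_mono) auto
    also have "\<dots> = integral {x..y} (\<lambda>s. \<bar>\<Phi> y\<bar>)" using xy by simp
    also have "\<dots> \<le> integral {x..y} (\<lambda>s. \<bar>\<Phi> s\<bar> + C * (y - x))"
      using \<Phi>diff abs_int by (intro integral_le integrable_add sub) (auto, smt (verit))
    also have "\<dots> = integral {x..y} (\<lambda>s. \<bar>\<Phi> s\<bar>) + C * (y - x)\<^sup>2"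
      using xy abs_int by (subst Henstock_Kurzweil_Integration.integral_add)
        (auto intro: sub simp: power2_eq_square)
    finally have 2: "- (\<Phi> y * (f y - f x)) \<le> integral {x..y} (\<lambda>s. \<bar>\<Phi> s\<bar>) + C * (y - x)\<^sup>2" .
    have 3: "integral {x..y} \<phi> = \<Phi> y - \<Phi> x" using comb[OF \<phi>(1)] by (simp add: \<Phi>_def)
    show "J x - 2 * C * (y - x)\<^sup>2 \<le> J y"
      using 1 2 unfolding 3 J_def comb[OF \<phi>(2)] comb[OF abs_int] by (simp add: algebra_simps)
  qed auto
  then show ?thesis using 0 by (simp add: J_def \<Phi>_def)
qed

section \<open>Upper bound: area under the bridge\<close>

text \<open>The bridge \<open>u\<close> rises from \<open>- l * a\<close> to \<open>l * a\<close>
  with slopes between \<open>- (1 + l)\<close> and \<open>1 - l\<close>. Outside its outer zeros its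
  sign is known, which sharpens the bound there; \<open>bridge_area_le\<close> covers all positions
  of these zeros. The summand \<open>l * a\<^sup>2\<close> is the area of the two triangles over
  \<open>[0, a]\<close> and \<open>[1 - a, 1]\<close>.\<close>

lemma integral_abs_bridge_le:
  fixes S :: "real \<Rightarrow> real"
  assumes a: "a * a = 4 * a - 1" "0 < a" and h: "h = 1/2 - a" "0 < h" "h \<le> a"
    and S: "1-lipschitz_on {a..1 - a} S" "S a = 0" "S (1 - a) = l" and l: "0 \<le> l"
  shows "l * a\<^sup>2 + integral {a..1 - a} (\<lambda>x. \<bar>S x - l * x\<bar>) \<le> h * a"
proof -
  define b where "b = 1 - a"
  define u where "u x = S x - l * x" for x
  have ab: "a < b" using h by (simp add: b_def)
  have S_lip: "\<bar>S y - S x\<bar> \<le> y - x" if "a \<le> x" "x \<le> y" "y \<le> b" for x y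
    using lipschitz_onD[OF S(1), of y x] that by (auto simp: dist_real_def b_def)
  have u_up: "u y - u x \<le> (1 - l) * (y - x)" and u_down: "u x - u y \<le> (1 + l) * (y - x)"
    if "a \<le> x" "x \<le> y" "y \<le> b" for x y
    using S_lip[OF that] by (auto simp: u_def algebra_simps)
  have l2: "l \<le> 2 * h" using S_lip[of a b] S ab by (simp add: b_def h(1))
  have "l < 1" using l2 h a by linarith
  have cont: "continuous_on {a..b} u"
    using lipschitz_on_continuous_on[OF S(1)] unfolding u_def b_def by (intro continuous_intros)
  have ua: "u a = - (l * a)" and ub: "u b = l * a"
    using S by (auto simp: u_def b_def algebra_simps)
  have la: "0 \<le> l * a" using l a by simp
  define Z where "Z = {x \<in> {a..b}. u x = 0}"
  have zero: "\<exists>z\<in>Z. x \<le> z \<and> z \<le> y" if "a \<le> x" "x \<le> y" "y \<le> b" "u x \<le> 0" "0 \<le> u y" for x y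
  proof -
    have "continuous_on {x..y} u" using cont by (rule continuous_on_subset) (use that in auto)
    with that IVT'[of u x 0 y] obtain z where "x \<le> z" "z \<le> y" "u z = 0" by auto
    with that show ?thesis by (intro bexI[of _ z]) (auto simp: Z_def)
  qed
  have "compact Z"
    unfolding Z_def compact_eq_bounded_closed
    using continuous_closed_preimage_constant[OF cont closed_atLeastAtMost]
    by (auto intro: bounded_subset[of "{a..b}"])
  moreover have "Z \<noteq> {}" using zero[of a b] ua ub la ab by auto
  ultimately obtain z1 z2 where z: "z1 \<in> Z" "\<And>x. x \<in> Z \<Longrightarrow> z1 \<le> x" "z2 \<in> Z" "\<And>x. x \<in> Z \<Longrightarrow> x \<le> z2"
    by (metis compact_attains_inf compact_attains_sup)
  have z_bounds: "a \<le> z1" "z1 \<le> z2" "z2 \<le> b" and uz: "u z1 = 0" "u z2 = 0"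
    using z by (auto simp: Z_def)
  \<comment> \<open>A positive value here would force a zero before \<open>z1\<close>, since
    \<open>u a \<le> 0\<close>.\<close>
  have neg: "u x \<le> 0" if x: "a \<le> x" "x \<le> z1" for x
  proof (rule ccontr)
    assume "\<not> u x \<le> 0"
    then obtain y where "y \<in> Z" "y \<le> x" using zero[of a x] x ua la z_bounds by auto
    with z(2) x have "x = z1" by force
    with uz \<open>\<not> u x \<le> 0\<close> show False by simp
  qed
  have pos: "0 \<le> u x" if x: "z2 \<le> x" "x \<le> b" for x
  proof (rule ccontr)
    assume "\<not> 0 \<le> u x"
    then obtain y where "y \<in> Z" "x \<le> y" using zero[of x b] x ub la z_bounds by auto
    with z(4) x have "x = z2" by force
    with uz \<open>\<not> 0 \<le> u x\<close> show False by simp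
  qed
  define d w d' where "d = z1 - a" and "w = z2 - z1" and "d' = b - z2"
  have dwd: "0 \<le> d" "0 \<le> w" "0 \<le> d'" "d + w + d' = 2 * h"
    using z_bounds by (auto simp: d_def w_def d'_def b_def h(1))
  \<comment> \<open>Climbing a height \<open>l * a\<close> with slope at most \<open>1 - l\<close>
    takes this much room.\<close>
  have d_ge: "l * a \<le> (1 - l) * d" and d'_ge: "l * a \<le> (1 - l) * d'"
    using u_up[of a z1] u_up[of z2 b] z_bounds uz ua ub by (auto simp: d_def d'_def)
  have *: "(1 - l) * d \<le> d" "(1 - l) * d' \<le> d'"
    using l dwd by (auto simp: algebra_simps)
  \<comment> \<open>On \<open>[a, z1]\<close> the lines \<open>l * a + (1 + l) * (x - a)\<close> and
    \<open>(1 - l) * (z1 - x)\<close> both bound \<open>- u x\<close>; they cross at distance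
    \<open>i\<close> from \<open>a\<close>. Symmetrically, \<open>j\<close> is measured from
    \<open>b\<close>.\<close>
  define i j where "i = ((1 - l) * d - l * a) / 2" and "j = ((1 - l) * d' - l * a) / 2"
  have ij: "0 \<le> i" "i \<le> d" "0 \<le> j" "j \<le> d'"
    using d_ge d'_ge * la dwd by (auto simp: i_def j_def)
  have "integral {a..z1} (\<lambda>x. \<bar>u x\<bar>) \<le> l * a * (a + i - a) + (1 + l) * (a + i - a)\<^sup>2 / 2
      + (0 * (z1 - (a + i)) + (1 - l) * (z1 - (a + i))\<^sup>2 / 2)"
  proof (rule integral_abs_le_tent)
    show "continuous_on {a..z1} u" using cont by (rule continuous_on_subset) (use z_bounds in auto)
    show "\<bar>u x\<bar> \<le> l * a + (1 + l) * (x - a)" if "a \<le> x" "x \<le> a + i" for x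
      using u_down[of a x] neg[of x] that ij z_bounds ua by (auto simp: d_def algebra_simps)
    show "\<bar>u x\<bar> \<le> 0 + (1 - l) * (z1 - x)" if "a + i \<le> x" "x \<le> z1" for x
      using u_up[of x z1] neg[of x] that ij z_bounds uz by auto
  qed (use ij in \<open>auto simp: d_def\<close>)
  also have "\<dots> = (1 - l\<^sup>2) * d\<^sup>2 / 4 + (1 - l) * (l * a) * d / 2 - (l * a)\<^sup>2 / 4"
    by (simp add: i_def d_def power2_eq_square field_simps)
  finally have left: "integral {a..z1} (\<lambda>x. \<bar>u x\<bar>) \<le> \<dots>" .
  \<comment> \<open>Between the outer zeros the sign is unknown, so the larger slope
    \<open>1 + l\<close> is used from both ends and the lines meet at the midpoint.\<close>
  have "integral {z1..z2} (\<lambda>x. \<bar>u x\<bar>) \<le> 0 * ((z1 + z2) / 2 - z1) + (1 + l) * ((z1 + z2) / 2 - z1)\<^sup>2 / 2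
      + (0 * (z2 - (z1 + z2) / 2) + (1 + l) * (z2 - (z1 + z2) / 2)\<^sup>2 / 2)"
  proof (rule integral_abs_le_tent)
    show "continuous_on {z1..z2} u" using cont by (rule continuous_on_subset) (use z_bounds in auto)
    have le: "(1 - l) * t \<le> (1 + l) * t" if "0 \<le> t" for t :: real
      using that l by (intro mult_right_mono) auto
    show "\<bar>u x\<bar> \<le> 0 + (1 + l) * (x - z1)" if "z1 \<le> x" "x \<le> (z1 + z2) / 2" for x
      using u_down[of z1 x] u_up[of z1 x] le[of "x - z1"] that z_bounds uz
      by (auto simp: abs_le_iff)
    show "\<bar>u x\<bar> \<le> 0 + (1 + l) * (z2 - x)" if "(z1 + z2) / 2 \<le> x" "x \<le> z2" for x
      using u_down[of x z2] u_up[of x z2] le[of "z2 - x"] that z_bounds uz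
      by (auto simp: abs_le_iff)
  qed (use z_bounds in auto)
  also have "\<dots> = (1 + l) * w\<^sup>2 / 4"
    by (simp add: w_def power2_eq_square field_simps)
  finally have mid: "integral {z1..z2} (\<lambda>x. \<bar>u x\<bar>) \<le> \<dots>" .
  have "integral {z2..b} (\<lambda>x. \<bar>u x\<bar>) \<le> 0 * (b - j - z2) + (1 - l) * (b - j - z2)\<^sup>2 / 2
      + (l * a * (b - (b - j)) + (1 + l) * (b - (b - j))\<^sup>2 / 2)"
  proof (rule integral_abs_le_tent)
    show "continuous_on {z2..b} u" using cont by (rule continuous_on_subset) (use z_bounds in auto)
    show "\<bar>u x\<bar> \<le> 0 + (1 - l) * (x - z2)" if "z2 \<le> x" "x \<le> b - j" for x
      using u_up[of z2 x] pos[of x] that ij z_bounds uz by auto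
    show "\<bar>u x\<bar> \<le> l * a + (1 + l) * (b - x)" if "b - j \<le> x" "x \<le> b" for x
      using u_down[of x b] pos[of x] that ij z_bounds ub by (auto simp: d'_def algebra_simps)
  qed (use ij in \<open>auto simp: d'_def\<close>)
  also have "\<dots> = (1 - l\<^sup>2) * d'\<^sup>2 / 4 + (1 - l) * (l * a) * d' / 2 - (l * a)\<^sup>2 / 4"
    by (simp add: j_def d'_def power2_eq_square field_simps)
  finally have right: "integral {z2..b} (\<lambda>x. \<bar>u x\<bar>) \<le> \<dots>" .
  have int: "(\<lambda>x. \<bar>u x\<bar>) integrable_on {a..b}"
    using cont by (intro integrable_continuous_real continuous_intros)
  have "integral {a..b} (\<lambda>x. \<bar>u x\<bar>) = integral {a..z1} (\<lambda>x. \<bar>u x\<bar>)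
      + (integral {z1..z2} (\<lambda>x. \<bar>u x\<bar>) + integral {z2..b} (\<lambda>x. \<bar>u x\<bar>))"
    using Henstock_Kurzweil_Integration.integral_combine[OF _ _ int, of z1]
      Henstock_Kurzweil_Integration.integral_combine[of z1 z2 b "\<lambda>x. \<bar>u x\<bar>"]
      integrable_subinterval_real[OF int, of z1 b] z_bounds by auto
  with left mid right bridge_area_le[OF a h l l2 dwd(4,2) d_ge d'_ge dwd(1,3)]
  have "l * a\<^sup>2 + integral {a..b} (\<lambda>x. \<bar>u x\<bar>) \<le> h * a"
    by (simp add: field_simps)
  then show ?thesis by (simp add: u_def b_def)
qed

section \<open>Upper bound: mean absolute deviation over the sampling interval\<close>

text \<open>The sampling interval has length \<open>2 * h\<close>, so the bound \<open>h * a\<close>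
  amounts to a mean error of at most \<open>a / 2\<close>. The sign hypothesis says that the slope
  parameter \<open>l\<close> of the bridge is nonnegative.\<close>

lemma integral_abs_diff_Avg_le_aux:
  fixes f :: "real \<Rightarrow> real"
  assumes a: "a * a = 4 * a - 1" "0 < a" and h: "h = 1/2 - a" "0 < h" "h \<le> a"
    and f: "1-lipschitz_on {0..1} f"
    and sgn_nonneg: "0 \<le> integral {a..1 - a} (\<lambda>x. sgn (f x - Avg f))"
  shows "integral {a..1 - a} (\<lambda>x. \<bar>Avg f - f x\<bar>) \<le> h * a"
proof -
  define b where "b = 1 - a"
  have ab: "0 < a" "a < b" "b < 1" using a h by (auto simp: b_def)
  define f0 where "f0 x = f x - Avg f" for x
  have f0: "1-lipschitz_on {0..1} f0"
    using f by (auto simp: f0_def lipschitz_on_def dist_real_def)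
  have f0_cont: "continuous_on {0..1} f0" by (rule lipschitz_on_continuous_on[OF f0])
  have f0_int: "(f0 has_integral 0) {0..1}"
  proof -
    have "(f has_integral Avg f) {0..1}"
      unfolding Avg_def using lipschitz_on_continuous_on[OF f]
      by (intro integrable_integral integrable_continuous_real)
    from has_integral_diff[OF this has_integral_const_real[of "Avg f" 0 1]]
    show ?thesis by (simp add: f0_def[abs_def])
  qed
  define \<sigma> where "\<sigma> x = sgn (f0 x)" for x
  \<comment> \<open>The zero set of \<open>f0\<close> can be complicated, so integrability of its
    sign comes from measurability and boundedness.\<close>
  have \<sigma>_int: "\<sigma> integrable_on {a..b}"
  proof (rule measurable_bounded_by_integrable_imp_integrable)
    have "f0 \<in> borel_measurable (lebesgue_on {a..b})"
      using ab by (intro continuous_imp_measurable_on_sets_lebesgue continuous_on_subset[OF f0_cont]) auto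
    then show "\<sigma> \<in> borel_measurable (lebesgue_on {a..b})"
      unfolding \<sigma>_def[abs_def] sgn_real_def by measurable
    show "(\<lambda>x. 1::real) integrable_on {a..b}" by (rule integrable_const_ivl)
  qed (auto simp: \<sigma>_def sgn_real_def)
  define l where "l = integral {a..b} \<sigma>"
  have l: "0 \<le> l" using sgn_nonneg by (simp add: l_def b_def \<sigma>_def[abs_def] f0_def)
  define S where "S y = integral {a..y} \<sigma>" for y
  have S_lip: "1-lipschitz_on {a..b} S"
  proof (rule lipschitz_on_leI)
    fix x y assume xy: "x \<in> {a..b}" "y \<in> {a..b}" "x \<le> y"
    have "S y - S x = integral {x..y} \<sigma>"
      using Henstock_Kurzweil_Integration.integral_combine[of a x y \<sigma>]
        integrable_subinterval_real[OF \<sigma>_int, of a y] xy by (auto simp: S_def)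
    moreover have "norm (integral {x..y} \<sigma>) \<le> 1 * (y - x)"
      using xy integrable_subinterval_real[OF \<sigma>_int, of x y]
        has_integral_bound_real[of 1 "{}" \<sigma> "integral {x..y} \<sigma>" x y]
      by (auto simp: integrable_integral \<sigma>_def sgn_real_def)
    ultimately show "dist (S x) (S y) \<le> 1 * dist x y"
      using xy by (simp add: dist_real_def abs_minus_commute)
  qed auto
  \<comment> \<open>Subtracting the constant \<open>l\<close> gives \<open>\<phi>\<close> integral 0
    and leaves its integral against \<open>f0\<close> unchanged, because \<open>f0\<close> itself
    has integral 0.\<close>
  define \<phi> where "\<phi> x = (if x \<in> {a..b} then \<sigma> x else 0) - l" for x
  have ab_sub: "{a..b} \<subseteq> {0..1}" using ab by auto
  have "((\<lambda>x. if x \<in> {a..b} then \<sigma> x else 0) has_integral l) {0..1}"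
    using \<sigma>_int unfolding has_integral_restrict[OF ab_sub] l_def by (rule integrable_integral)
  from has_integral_diff[OF this has_integral_const_real[of l 0 1]]
  have \<phi>_int: "(\<phi> has_integral l - l) {0..1}"
    by (simp add: \<phi>_def[abs_def])
  have "(\<lambda>x. \<bar>f0 x\<bar>) integrable_on {a..b}"
    using f0_cont ab_sub by (intro integrable_continuous_real continuous_intros) (rule continuous_on_subset)
  then have "((\<lambda>x. if x \<in> {a..b} then \<bar>f0 x\<bar> else 0)
      has_integral integral {a..b} (\<lambda>x. \<bar>f0 x\<bar>)) {0..1}"
    unfolding has_integral_restrict[OF ab_sub] by (rule integrable_integral)
  from has_integral_diff[OF this has_integral_mult_right[OF f0_int, of l]]
  have "((\<lambda>x. (if x \<in> {a..b} then \<bar>f0 x\<bar> else 0) - l * f0 x)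
      has_integral integral {a..b} (\<lambda>x. \<bar>f0 x\<bar>)) {0..1}"
    by simp
  moreover have "(if x \<in> {a..b} then \<bar>f0 x\<bar> else 0) - l * f0 x = \<phi> x * f0 x" for x
    by (auto simp: \<phi>_def \<sigma>_def abs_sgn algebra_simps)
  ultimately have \<phi>f_int: "((\<lambda>x. \<phi> x * f0 x) has_integral integral {a..b} (\<lambda>x. \<bar>f0 x\<bar>)) {0..1}"
    by simp
  define \<Phi> where "\<Phi> y = integral {0..y} \<phi>" for y
  have \<Phi>: "\<Phi> y = integral ({0..y} \<inter> {a..b}) \<sigma> - l * y" if "0 \<le> y" "y \<le> 1" for y
  proof -
    have "(\<lambda>x. if x \<in> {a..b} then \<sigma> x else 0) integrable_on {0..1}"
      using \<sigma>_int has_integral_restrict[OF ab_sub, of \<sigma>] by (auto simp: integrable_on_def)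
    then have "(\<lambda>x. if x \<in> {a..b} then \<sigma> x else 0) integrable_on {0..y}"
      by (rule integrable_subinterval_real) (use that in auto)
    then have "\<Phi> y = integral {0..y} (\<lambda>x. if x \<in> {a..b} then \<sigma> x else 0) - integral {0..y} (\<lambda>x. l)"
      unfolding \<Phi>_def \<phi>_def by (rule Henstock_Kurzweil_Integration.integral_diff) (rule integrable_const_ivl)
    then show ?thesis
      unfolding Henstock_Kurzweil_Integration.integral_restrict_Int Int_commute[of "{a..b}"]
      using that by simp
  qed
  have \<Phi>1: "\<Phi> y = - l * y" if "0 \<le> y" "y \<le> a" for y
  proof (cases "y = a")
    case True
    then have inter: "{0..y} \<inter> {a..b} = {a..a}" using ab by auto
    show ?thesis using \<Phi>[of y] that ab unfolding inter by simp
  next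
    case False
    then have inter: "{0..y} \<inter> {a..b} = {}" using that by auto
    show ?thesis using \<Phi>[of y] that ab unfolding inter by simp
  qed
  have \<Phi>2: "\<Phi> y = S y - l * y" if "a \<le> y" "y \<le> b" for y
  proof -
    have inter: "{0..y} \<inter> {a..b} = {a..y}" using that ab by auto
    show ?thesis using \<Phi>[of y] that ab unfolding inter by (simp add: S_def)
  qed
  have \<Phi>3: "\<Phi> y = l * (1 - y)" if "b \<le> y" "y \<le> 1" for y
  proof -
    have inter: "{0..y} \<inter> {a..b} = {a..b}" using that ab by auto
    show ?thesis using \<Phi>[of y] that ab unfolding inter by (simp add: l_def algebra_simps)
  qed
  have \<Phi>_cont: "continuous_on {0..1} \<Phi>"
    unfolding \<Phi>_def using \<phi>_int by (intro indefinite_integral_continuous_1) auto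
  then have \<Phi>_int: "(\<lambda>y. \<bar>\<Phi> y\<bar>) integrable_on {0..1}"
    by (intro integrable_continuous_real continuous_intros)
  have "integral {a..b} (\<lambda>x. \<bar>f0 x\<bar>) \<le> integral {0..1} (\<lambda>y. \<bar>\<Phi> y\<bar>)"
    unfolding integral_unique[OF \<phi>f_int, symmetric] \<Phi>_def
  proof (rule integral_mult_lipschitz_le[OF f0])
    show "\<bar>\<phi> x\<bar> \<le> 1 + l" for x
      using l by (auto simp: \<phi>_def \<sigma>_def sgn_real_def)
  qed (use \<phi>_int \<phi>f_int in auto)
  also have "\<dots> = integral {0..a} (\<lambda>y. \<bar>\<Phi> y\<bar>) + (integral {a..b} (\<lambda>y. \<bar>\<Phi> y\<bar>) + integral {b..1} (\<lambda>y. \<bar>\<Phi> y\<bar>))"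
    using Henstock_Kurzweil_Integration.integral_combine[OF _ _ \<Phi>_int, of a]
      Henstock_Kurzweil_Integration.integral_combine[of a b 1 "\<lambda>x. \<bar>\<Phi> x\<bar>"]
      integrable_subinterval_real[OF \<Phi>_int, of a 1] ab by auto
  \<comment> \<open>Degenerate tents: on \<open>[0, a]\<close> and on \<open>[b, 1]\<close>,
    \<open>\<bar>\<Phi>\<bar>\<close> is a single line of slope \<open>l\<close> or
    \<open>- l\<close>, so each piece contributes \<open>l * a\<^sup>2 / 2\<close>.\<close>
  also have "integral {0..a} (\<lambda>y. \<bar>\<Phi> y\<bar>) \<le> 0 * (a - 0) + l * (a - 0)\<^sup>2 / 2 + (l * a * (a - a) + 0 * (a - a)\<^sup>2 / 2)"
    using ab l by (intro integral_abs_le_tent continuous_on_subset[OF \<Phi>_cont]) (auto simp: \<Phi>1 abs_mult)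
  also have "integral {b..1} (\<lambda>y. \<bar>\<Phi> y\<bar>) \<le> l * (1 - b) * (b - b) + 0 * (b - b)\<^sup>2 / 2 + (0 * (1 - b) + l * (1 - b)\<^sup>2 / 2)"
    using ab l by (intro integral_abs_le_tent continuous_on_subset[OF \<Phi>_cont]) (auto simp: \<Phi>3 abs_mult)
  also have "integral {a..b} (\<lambda>y. \<bar>\<Phi> y\<bar>) = integral {a..b} (\<lambda>y. \<bar>S y - l * y\<bar>)"
    by (intro Henstock_Kurzweil_Integration.integral_cong) (simp add: \<Phi>2)
  finally have "integral {a..b} (\<lambda>x. \<bar>f0 x\<bar>) \<le> l * a\<^sup>2 + integral {a..b} (\<lambda>y. \<bar>S y - l * y\<bar>)"
    by (simp add: b_def)
  also have "\<dots> \<le> h * a"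
    unfolding b_def using S_lip by (intro integral_abs_bridge_le a h l) (auto simp: b_def S_def l_def)
  finally show ?thesis by (simp add: f0_def b_def abs_minus_commute)
qed

text \<open>Replacing \<open>f\<close> by its negative reverses the sign of \<open>l\<close> and
  preserves the error.\<close>

lemma integral_abs_diff_Avg_le:
  fixes f :: "real \<Rightarrow> real"
  assumes a: "a * a = 4 * a - 1" "0 < a" and h: "h = 1/2 - a" "0 < h" "h \<le> a"
    and f: "1-lipschitz_on {0..1} f"
  shows "integral {a..1 - a} (\<lambda>x. \<bar>Avg f - f x\<bar>) \<le> h * a"
proof (cases "0 \<le> integral {a..1 - a} (\<lambda>x. sgn (f x - Avg f))")
  case True
  then show ?thesis by (rule integral_abs_diff_Avg_le_aux[OF a h f])
next
  case False
  have Avg: "Avg (\<lambda>x. - f x) = - Avg f" by (simp add: Avg_def)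
  have "sgn (Avg f - f x) = - sgn (f x - Avg f)" for x
    by (simp add: sgn_real_def)
  then have "0 \<le> integral {a..1 - a} (\<lambda>x. sgn (- f x - Avg (\<lambda>x. - f x)))"
    using False by (simp add: Avg)
  from integral_abs_diff_Avg_le_aux[OF a h lipschitz_on_minus[OF f] this]
  show ?thesis by (simp add: Avg abs_minus_commute)
qed

section \<open>Lower bound: averaging over signs and vertical shifts of a shape\<close>

lemma Avg_has_integral:
  assumes "1-lipschitz_on {0..1} f"
  shows "(f has_integral Avg f) {0..1}"
  unfolding Avg_def using lipschitz_on_continuous_on[OF assms]
  by (intro integrable_integral integrable_continuous_real)

text \<open>Joint measurability in the sample point and the shift \<open>c\<close> allows the two
  integrations to be exchanged.\<close>

lemma expected_error_measurable:
  fixes p s :: "real \<Rightarrow> real" and g :: "real \<times> real \<Rightarrow> real"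
  assumes alg: "randomized_sampling_alg (p, g)" and s: "continuous_on {0..1} s"
  shows "(\<lambda>(x, c). ennreal (p x * \<bar>c - g (x, s x + c)\<bar>)) \<in> borel_measurable (lebesgue_on {0..1} \<Otimes>\<^sub>M lborel)"
proof -
  have [measurable]: "p \<in> borel_measurable (lebesgue_on {0..1})"
      "g \<in> borel_measurable (lebesgue_on {0..1} \<Otimes>\<^sub>M borel)"
    using alg by (auto simp: randomized_sampling_alg_def prob_density_def)
  have [measurable]: "s \<in> borel_measurable (lebesgue_on {0..1})"
    using s by (rule continuous_imp_measurable_on_sets_lebesgue) auto
  show ?thesis by measurable
qed

text \<open>The functions \<open>s + c\<close> and \<open>- s + c\<close> have average
  \<open>c\<close>. Integrating their errors over \<open>c\<close> in \<open>[-K, K]\<close> gives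
  at most \<open>2 * K\<close> times the worst case for each sign. For a fixed sample point and
  observed value, the two signs require different answers, at distance
  \<open>2 * \<bar>s x\<bar>\<close>.\<close>

lemma shape_le_worst_case_error:
  fixes s :: "real \<Rightarrow> real" and K :: real
  assumes alg: "randomized_sampling_alg (p, g)"
    and s: "1-lipschitz_on {0..1} s" "Avg s = 0" "\<And>x. x \<in> {0..1} \<Longrightarrow> \<bar>s x\<bar> \<le> 1" and K: "1 \<le> K"
  shows "(\<integral>\<^sup>+x. ennreal (p x * (2 * \<bar>s x\<bar> * (2 * K - 2))) \<partial>lebesgue_on {0..1})
    \<le> ennreal (4 * K) * worst_case_error (p, g)" (is "_ \<le> _ * ?W")
proof -
  let ?M = "lebesgue_on {0..1::real}"
  interpret M: finite_measure ?M by (rule finite_measure_lebesgue_on) simp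
  interpret P: pair_sigma_finite ?M lborel ..
  have p: "0 \<le> p x" if "x \<in> {0..1}" for x
    using alg that by (auto simp: randomized_sampling_alg_def prob_density_def)
  define E where "E r x c = ennreal (p x * \<bar>c - g (x, r x + c)\<bar>) * indicator {-K..K} c"
    for r :: "real \<Rightarrow> real" and x c
  have E_meas: "case_prod (E r) \<in> borel_measurable (?M \<Otimes>\<^sub>M lborel)" if "continuous_on {0..1} r" for r
  proof -
    have "(\<lambda>z. (case z of (x, c) \<Rightarrow> ennreal (p x * \<bar>c - g (x, r x + c)\<bar>)) * indicator {-K..K} (snd z))
        \<in> borel_measurable (?M \<Otimes>\<^sub>M lborel)"
      using expected_error_measurable[OF alg that] by measurable
    then show ?thesis by (simp add: E_def case_prod_unfold)
  qed
  have bound: "(\<integral>\<^sup>+x. \<integral>\<^sup>+c. E r x c \<partial>lborel \<partial>?M) \<le> ennreal (2 * K) * ?W"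
    if r: "1-lipschitz_on {0..1} r" "Avg r = 0" for r
  proof -
    note meas = E_meas[OF lipschitz_on_continuous_on[OF r(1)]]
    have "(\<integral>\<^sup>+x. \<integral>\<^sup>+c. E r x c \<partial>lborel \<partial>?M) = (\<integral>\<^sup>+c. \<integral>\<^sup>+x. E r x c \<partial>?M \<partial>lborel)"
      by (rule P.Fubini'[symmetric, OF meas])
    also have "\<dots> \<le> (\<integral>\<^sup>+c. ?W * indicator {-K..K} c \<partial>lborel)"
    proof (rule nn_integral_mono)
      fix c :: real
      have lip: "1-lipschitz_on {0..1} (\<lambda>x. r x + c)"
        using r(1) by (auto simp: lipschitz_on_def dist_real_def)
      have "((\<lambda>x. r x + c) has_integral 0 + c) {0..1}"
        using has_integral_add[OF Avg_has_integral[OF r(1)] has_integral_const_real[of c 0 1]] r(2) by simp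
      then have "Avg (\<lambda>x. r x + c) = c" by (auto simp: Avg_def)
      then have "(\<integral>\<^sup>+x. E r x c \<partial>?M) = expected_error (p, g) (\<lambda>x. r x + c) * indicator {-K..K} c"
        by (auto simp: E_def expected_error_def indicator_def)
      also have "\<dots> \<le> ?W * indicator {-K..K} c"
        unfolding worst_case_error_def using lip by (intro mult_right_mono SUP_upper) auto
      finally show "(\<integral>\<^sup>+x. E r x c \<partial>?M) \<le> ?W * indicator {-K..K} c" .
    qed
    also have "\<dots> = ennreal (2 * K) * ?W"
      using K by (simp add: nn_integral_cmult mult.commute)
    finally show ?thesis .
  qed
  define s' where "s' x = - s x" for x
  have s': "1-lipschitz_on {0..1} s'" "Avg s' = 0"
    using s lipschitz_on_minus[OF s(1)] by (auto simp: s'_def[abs_def] Avg_def)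
  note meas = E_meas[OF lipschitz_on_continuous_on[OF s(1)]] E_meas[OF lipschitz_on_continuous_on[OF s'(1)]]
  have "ennreal (p x * (2 * \<bar>s x\<bar> * (2 * K - 2))) \<le> (\<integral>\<^sup>+c. E s x c \<partial>lborel) + (\<integral>\<^sup>+c. E s' x c \<partial>lborel)"
    if x: "x \<in> {0..1}" for x
  proof -
    have [measurable]: "E s x \<in> borel_measurable borel" "E s' x \<in> borel_measurable borel"
      using measurable_Pair2[OF meas(1), of x] measurable_Pair2[OF meas(2), of x] x by auto
    \<comment> \<open>Change of variable from the shift \<open>c\<close> to the observed value
      \<open>y = r x + c\<close>, after which both signs see the same prediction
      \<open>g (x, y)\<close>.\<close>
    have shift: "(\<integral>\<^sup>+c. E r x c \<partial>lborel) = (\<integral>\<^sup>+y. E r x (y - r x) \<partial>lborel)"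
      if "E r x \<in> borel_measurable borel" for r
      using nn_integral_real_affine[OF that, of 1 "- r x"] by simp
    have "ennreal (p x * (2 * \<bar>s x\<bar> * (2 * K - 2))) = ennreal (p x * (2 * \<bar>s x\<bar>)) * ennreal (2 * K - 2)"
      using p[OF x] K by (simp add: ennreal_mult'[symmetric] mult.assoc)
    \<comment> \<open>Since \<open>\<bar>s x\<bar> \<le> 1\<close>, every \<open>y\<close> in this
      shorter interval comes from admissible shifts for both signs; its length is
      \<open>2 * K - 2\<close>.\<close>
    also have "\<dots> = (\<integral>\<^sup>+y. ennreal (p x * (2 * \<bar>s x\<bar>)) * indicator {1 - K..K - 1} y \<partial>lborel)"
      using K by (simp add: nn_integral_cmult)
    also have "\<dots> \<le> (\<integral>\<^sup>+y. E s x (y - s x) + E s' x (y - s' x) \<partial>lborel)"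
    proof (rule nn_integral_mono)
      fix y :: real
      show "ennreal (p x * (2 * \<bar>s x\<bar>)) * indicator {1 - K..K - 1} y \<le> E s x (y - s x) + E s' x (y - s' x)"
      proof (cases "y \<in> {1 - K..K - 1}")
        case True
        have "y - s x \<in> {-K..K}" "y + s x \<in> {-K..K}" using True s(3)[OF x] by (auto simp: abs_le_iff)
        then have "E s x (y - s x) + E s' x (y - s' x)
            = ennreal (p x * (\<bar>y - s x - g (x, y)\<bar> + \<bar>y + s x - g (x, y)\<bar>))"
          using p[OF x] by (simp add: E_def s'_def ennreal_plus[symmetric] distrib_left del: ennreal_plus)
        moreover have "2 * \<bar>s x\<bar> \<le> \<bar>y - s x - g (x, y)\<bar> + \<bar>y + s x - g (x, y)\<bar>" by linarith
        ultimately show ?thesis using True p[OF x] by (auto intro!: ennreal_leI mult_left_mono)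
      qed simp
    qed
    also have "\<dots> = (\<integral>\<^sup>+c. E s x c \<partial>lborel) + (\<integral>\<^sup>+c. E s' x c \<partial>lborel)"
      by (simp add: shift nn_integral_add)
    finally show ?thesis .
  qed
  then have "(\<integral>\<^sup>+x. ennreal (p x * (2 * \<bar>s x\<bar> * (2 * K - 2))) \<partial>?M)
      \<le> (\<integral>\<^sup>+x. (\<integral>\<^sup>+c. E s x c \<partial>lborel) + (\<integral>\<^sup>+c. E s' x c \<partial>lborel) \<partial>?M)"
    by (intro nn_integral_mono) auto
  also have "\<dots> = (\<integral>\<^sup>+x. \<integral>\<^sup>+c. E s x c \<partial>lborel \<partial>?M) + (\<integral>\<^sup>+x. \<integral>\<^sup>+c. E s' x c \<partial>lborel \<partial>?M)"
    using meas[THEN lborel.borel_measurable_nn_integral] by (intro nn_integral_add) auto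
  also have "\<dots> \<le> ennreal (2 * K) * ?W + ennreal (2 * K) * ?W"
    by (intro add_mono bound s s')
  also have "\<dots> = ennreal (4 * K) * ?W"
    using K by (simp add: distrib_right[symmetric] ennreal_plus[symmetric] del: ennreal_plus)
  finally show ?thesis .
qed

text \<open>Two shapes are combined because a single one may vanish where \<open>p\<close>
  concentrates. Their joint pointwise bound lets \<open>p\<close> integrate out to 1, and the loss
  from the ends of \<open>[-K, K]\<close> disappears as \<open>K\<close> grows.\<close>

lemma worst_case_error_ge:
  assumes alg: "randomized_sampling_alg (p, g)"
    and s: "1-lipschitz_on {0..1} s" "Avg s = 0" "\<And>x. x \<in> {0..1} \<Longrightarrow> \<bar>s x\<bar> \<le> 1"
    and s': "1-lipschitz_on {0..1} s'" "Avg s' = 0" "\<And>x. x \<in> {0..1} \<Longrightarrow> \<bar>s' x\<bar> \<le> 1"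
    and v: "\<And>x. x \<in> {0..1} \<Longrightarrow> 2 * v \<le> \<bar>s x\<bar> + \<bar>s' x\<bar>" "0 \<le> v"
  shows "ennreal v \<le> worst_case_error (p, g)"
proof (cases "worst_case_error (p, g)")
  case (real w)
  let ?M = "lebesgue_on {0..1::real}"
  have p: "0 \<le> p x" if "x \<in> {0..1}" for x
    using alg that by (auto simp: randomized_sampling_alg_def prob_density_def)
  have [measurable]: "p \<in> borel_measurable ?M"
    using alg by (auto simp: randomized_sampling_alg_def prob_density_def)
  have [measurable]: "s \<in> borel_measurable ?M" "s' \<in> borel_measurable ?M"
    using s s' by (auto intro!: continuous_imp_measurable_on_sets_lebesgue lipschitz_on_continuous_on)
  have K_bound: "v * (K - 1) \<le> w * K" if K: "1 \<le> K" for K :: real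
  proof -
    have "ennreal (4 * v * (2 * K - 2)) = ennreal (4 * v * (2 * K - 2)) * (\<integral>\<^sup>+x. ennreal (p x) \<partial>?M)"
      using alg by (simp add: randomized_sampling_alg_def prob_density_def)
    also have "\<dots> = (\<integral>\<^sup>+x. ennreal (4 * v * (2 * K - 2)) * ennreal (p x) \<partial>?M)"
      by (simp add: nn_integral_cmult)
    also have "\<dots> \<le> (\<integral>\<^sup>+x. ennreal (p x * (2 * \<bar>s x\<bar> * (2 * K - 2)))
        + ennreal (p x * (2 * \<bar>s' x\<bar> * (2 * K - 2))) \<partial>?M)"
    proof (rule nn_integral_mono)
      fix x assume "x \<in> space ?M"
      then have x: "x \<in> {0..1}" by simp
      have "4 * v * (2 * K - 2) * p x \<le> 2 * (\<bar>s x\<bar> + \<bar>s' x\<bar>) * (2 * K - 2) * p x"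
        using v(1)[OF x] p[OF x] K by (intro mult_right_mono) auto
      then show "ennreal (4 * v * (2 * K - 2)) * ennreal (p x)
          \<le> ennreal (p x * (2 * \<bar>s x\<bar> * (2 * K - 2))) + ennreal (p x * (2 * \<bar>s' x\<bar> * (2 * K - 2)))"
        using p[OF x] K v(2)
        by (subst ennreal_plus[symmetric], simp, simp, subst ennreal_mult'[symmetric], simp)
          (intro ennreal_leI, simp add: algebra_simps)
    qed
    also have "\<dots> = (\<integral>\<^sup>+x. ennreal (p x * (2 * \<bar>s x\<bar> * (2 * K - 2))) \<partial>?M)
        + (\<integral>\<^sup>+x. ennreal (p x * (2 * \<bar>s' x\<bar> * (2 * K - 2))) \<partial>?M)"
      by (intro nn_integral_add) measurable
    also have "\<dots> \<le> ennreal (4 * K) * ennreal w + ennreal (4 * K) * ennreal w"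
      unfolding real(2)[symmetric] using K alg s s' by (intro add_mono shape_le_worst_case_error) auto
    also have "\<dots> = ennreal (8 * K * w)"
      using K real(1) by (simp add: ennreal_plus[symmetric] ennreal_mult'[symmetric] del: ennreal_plus)
    finally have "4 * v * (2 * K - 2) \<le> 8 * K * w"
      using K real(1) by (simp add: ennreal_le_iff)
    then show ?thesis by (simp add: algebra_simps)
  qed
  have "v \<le> w"
  proof (rule ccontr)
    assume "\<not> v \<le> w"
    \<comment> \<open>\<open>K_bound\<close> gives \<open>K * (v - w) \<le> v\<close>, while this
      choice makes the left side at least \<open>v + 1\<close>.\<close>
    define K where "K = max 1 ((v + 1) / (v - w))"
    have "(v + 1) / (v - w) \<le> K" by (simp add: K_def)
    then have "v + 1 \<le> K * (v - w)" using \<open>\<not> v \<le> w\<close> by (simp add: field_simps)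
    moreover have "v * (K - 1) \<le> w * K" by (intro K_bound) (simp add: K_def)
    ultimately show False by (simp add: algebra_simps)
  qed
  then show ?thesis using real by (simp add: ennreal_leI)
qed simp

section \<open>Explicit integrals and the uniform sampling algorithm\<close>

lemma has_integral_abs_diff:
  fixes t :: real
  assumes "0 \<le> t" "t \<le> 1"
  shows "((\<lambda>x. \<bar>x - t\<bar>) has_integral t\<^sup>2 / 2 + (1 - t)\<^sup>2 / 2) {0..1}"
proof (rule has_integral_combine[OF assms])
  have "((\<lambda>x. t - x) has_integral t\<^sup>2 / 2) {0..t}"
    by (rule has_integral_eq_rhs[OF fundamental_theorem_of_calculus[OF assms(1),
          where f = "\<lambda>x. - (t - x)\<^sup>2 / 2"]])
      (auto intro!: derivative_eq_intros simp: field_simps simp flip: has_real_derivative_iff_has_vector_derivative)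
  then show "((\<lambda>x. \<bar>x - t\<bar>) has_integral t\<^sup>2 / 2) {0..t}"
    by (rule has_integral_eq[rotated]) auto
  have "((\<lambda>x. x - t) has_integral (1 - t)\<^sup>2 / 2) {t..1}"
    by (rule has_integral_eq_rhs[OF fundamental_theorem_of_calculus[OF assms(2),
          where f = "\<lambda>x. (x - t)\<^sup>2 / 2"]])
      (auto intro!: derivative_eq_intros simp flip: has_real_derivative_iff_has_vector_derivative)
  then show "((\<lambda>x. \<bar>x - t\<bar>) has_integral (1 - t)\<^sup>2 / 2) {t..1}"
    by (rule has_integral_eq[rotated]) auto
qed

text \<open>Translates the nonnegative Lebesgue integral of the definition into the gauge integral
  used for the upper bound.\<close>

lemma expected_error_uniform_density:
  assumes ab: "0 \<le> a" "a < b" "b \<le> 1" and f: "1-lipschitz_on {0..1} f"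
  shows "expected_error (uniform_density a b, \<lambda>(x, y). y) f
    = ennreal (integral {a..b} (\<lambda>x. \<bar>Avg f - f x\<bar>) / (b - a))"
proof -
  have "continuous_on {a..b} f"
    using lipschitz_on_continuous_on[OF f] by (rule continuous_on_subset) (use ab in auto)
  then have int: "((\<lambda>x. \<bar>Avg f - f x\<bar> / (b - a)) has_integral
      integral {a..b} (\<lambda>x. \<bar>Avg f - f x\<bar>) / (b - a)) {a..b}"
    by (intro has_integral_divide integrable_integral integrable_continuous_real continuous_intros)
  have "expected_error (uniform_density a b, \<lambda>(x, y). y) f
      = (\<integral>\<^sup>+x. ennreal (uniform_density a b x * \<bar>Avg f - f x\<bar>) * indicator {0..1} x \<partial>lebesgue)"
    by (simp add: expected_error_def nn_integral_restrict_space)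
  also have "\<dots> = (\<integral>\<^sup>+x. ennreal (indicator {a..b} x * (\<bar>Avg f - f x\<bar> / (b - a))) \<partial>lborel)"
    unfolding nn_integral_completion using ab
    by (intro nn_integral_cong) (auto simp: uniform_density_def indicator_def)
  also have "\<dots> = ennreal (integral {a..b} (\<lambda>x. \<bar>Avg f - f x\<bar>) / (b - a))"
    using ab by (intro nn_integral_has_integral_lebesgue[OF _ int]) auto
  finally show ?thesis .
qed

lemma randomized_sampling_alg_uniform:
  assumes ab: "0 \<le> a" "a < b" "b \<le> 1"
  shows "randomized_sampling_alg (uniform_density a b, \<lambda>(x, y). y)"
proof -
  have "(\<integral>\<^sup>+x. ennreal (uniform_density a b x) \<partial>lebesgue_on {0..1})
      = (\<integral>\<^sup>+x. ennreal (uniform_density a b x) * indicator {0..1} x \<partial>lebesgue)"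
    by (simp add: nn_integral_restrict_space)
  also have "\<dots> = (\<integral>\<^sup>+x. ennreal (1 / (b - a)) * indicator {a..b} x \<partial>lborel)"
    unfolding nn_integral_completion using ab
    by (intro nn_integral_cong) (auto simp: uniform_density_def indicator_def)
  also have "\<dots> = 1"
    using ab by (simp add: nn_integral_cmult ennreal_mult'[symmetric])
  finally have "(\<integral>\<^sup>+x. ennreal (uniform_density a b x) \<partial>lebesgue_on {0..1}) = 1" .
  moreover have "uniform_density a b \<in> borel_measurable (lebesgue_on {0..1})"
  proof -
    have "uniform_density a b \<in> borel_measurable borel"
      unfolding uniform_density_def[abs_def] by measurable
    then show ?thesis by (intro measurable_restrict_space1 measurable_completion) simp
  qed
  ultimately show ?thesis
    using ab by (simp add: randomized_sampling_alg_def prob_density_def uniform_density_def case_prod_unfold)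
qed

section \<open>Optimality: the two bounds meet at \<open>a / 2\<close>\<close>

theorem theorem4:
  fixes A :: sampling_alg
  defines "A \<equiv> (uniform_density (2 - sqrt 3) (sqrt 3 - 1), \<lambda>(x, y). y)"
  shows "is_arg_min worst_case_error randomized_sampling_alg A
    \<and> worst_case_error A = ennreal (1 - sqrt 3 / 2)"
proof -
  define a :: real where "a = 2 - sqrt 3"
  define h where "h = 1/2 - a"
  have sqrt3: "1.73 < sqrt 3" "sqrt 3 < 1.74"
    by (rule real_less_rsqrt, simp add: power2_eq_square)
      (rule real_less_lsqrt, simp_all add: power2_eq_square)
  have aa: "a * a = 4 * a - 1" by (simp add: a_def algebra_simps)
  have a: "0 < a" "0 < h" "h \<le> a" and b: "sqrt 3 - 1 = 1 - a" and v: "1 - sqrt 3 / 2 = a / 2"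
    using sqrt3 by (auto simp: a_def h_def field_simps)
  have A: "A = (uniform_density a (1 - a), \<lambda>(x, y). y)"
    by (simp add: A_def a_def)
  have alg: "randomized_sampling_alg A"
    unfolding A using a by (intro randomized_sampling_alg_uniform) (auto simp: h_def)
  have upper: "worst_case_error A \<le> ennreal (a / 2)"
    unfolding worst_case_error_def
  proof (rule SUP_least)
    fix f :: "real \<Rightarrow> real" assume "f \<in> {f. 1-lipschitz_on {0..1} f}"
    then have f: "1-lipschitz_on {0..1} f" by simp
    \<comment> \<open>Here \<open>1 - a - a = 2 * h\<close>, so dividing \<open>h * a\<close> by it
      leaves \<open>a / 2\<close>.\<close>
    have "integral {a..1 - a} (\<lambda>x. \<bar>Avg f - f x\<bar>) / (1 - a - a) \<le> a / 2"
      using integral_abs_diff_Avg_le[OF aa a(1) h_def a(2,3) f] a by (simp add: h_def field_simps)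
    then show "expected_error A f \<le> ennreal (a / 2)"
      unfolding A using a f by (subst expected_error_uniform_density) (auto simp: h_def intro: ennreal_leI)
  qed
  have lower: "ennreal (a / 2) \<le> worst_case_error (p, g)" if pg: "randomized_sampling_alg (p, g)" for p g
  proof -
    \<comment> \<open>With this centre the average of \<open>\<bar>x - t\<bar>\<close> on
      \<open>[0, 1]\<close> is \<open>(1 + a\<^sup>2) / 4\<close>, which equals \<open>a\<close> by
      \<open>aa\<close>; by symmetry the same holds for \<open>1 - t\<close>.\<close>
    define t where "t = (1 + a) / 2"
    define s where "s r x = \<bar>x - r\<bar> - a" for r x :: real
    have t: "0 \<le> t" "t \<le> 1" using a by (auto simp: t_def h_def)
    have lip: "1-lipschitz_on {0..1} (s r)" for r
      by (auto simp: lipschitz_on_def dist_real_def s_def)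
    have small: "\<bar>s r x\<bar> \<le> 1" if "x \<in> {0..1}" "0 \<le> r" "r \<le> 1" for r x
      using that a by (auto simp: s_def h_def)
    have Avg: "Avg (s r) = 0" if r: "0 \<le> r" "r \<le> 1" "r\<^sup>2 / 2 + (1 - r)\<^sup>2 / 2 = a" for r
      using has_integral_diff[OF has_integral_abs_diff[OF r(1,2)] has_integral_const_real[of a 0 1]] r(3)
      by (auto simp: Avg_def s_def[abs_def] intro: integral_unique)
    have eq: "t\<^sup>2 / 2 + (1 - t)\<^sup>2 / 2 = a" "(1 - t)\<^sup>2 / 2 + (1 - (1 - t))\<^sup>2 / 2 = a"
      using aa by (auto simp: t_def power2_eq_square field_simps)
    show ?thesis
    proof (rule worst_case_error_ge[OF pg, of "s t" "s (1 - t)"])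
      \<comment> \<open>The centres are \<open>a\<close> apart, so each shape vanishes at the centre
        of the other. The sum is exactly \<open>a\<close> from \<open>1 - t - a\<close> to
        \<open>t + a\<close> and larger outside.\<close>
      show "2 * (a / 2) \<le> \<bar>s t x\<bar> + \<bar>s (1 - t) x\<bar>" if "x \<in> {0..1}" for x
        using that a unfolding s_def t_def h_def by (auto simp: abs_if field_simps)
    qed (use t lip small Avg eq a in auto)
  qed
  have "worst_case_error A = ennreal (a / 2)"
    using upper lower alg unfolding A by (intro antisym) auto
  moreover have "\<not> worst_case_error B < worst_case_error A" if "randomized_sampling_alg B" for B
    using lower[of "fst B" "snd B"] that upper by (auto simp: not_less intro: order_trans)
  ultimately show ?thesis
    using alg by (auto simp: is_arg_min_def v)
qed

end
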